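(* Let $P$ be a discrete set of points in $\mathbb{R}^n$ and let $L$ be a fixed set of lines in $\mathbb{R}^n$, and suppose the maximum incidence $I=I(P,L)$ is finite and $I>2$. If $C$ is a positive integer with $C\geqslant 2I+10\sqrt{I}$, then there is a nonrepetitive $C$-coloring of $P$ with respect to $L$.
   Context: For a point $p\in P$, $i(p)$ denotes the number of lines of $L$ incident with $p$, and $I(P,L)=\max\{i(p): p\in P\}$ is the maximum incidence. A $C$-coloring of $P$ is an assignment of one of $C$ colors to each point of $P$. A finite sequence is nonrepetitive if no two adjacent blocks of consecutive terms are identical, i.e. it contains no block of the form $y_1\ldots y_h y_1\ldots y_h$ with $h\geqslant 1$. A coloring of $P$ is nonrepetitive with respect to $L$ if for each line $l\in L$, no sequence of consecutive points of $P$ on $l$ (in their order along $l$) has its sequence of colors forming such a repetition $y_1\ldots y_h y_1\ldots y_h$. *)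

theory Defs
  imports "HOL-Analysis.Analysis" "HOL-Library.Extended_Nat"
begin

definition is_line :: "'a::real_vector set \<Rightarrow> bool" where
  "is_line l \<longleftrightarrow> (\<exists>a v. v \<noteq> 0 \<and> l = range (\<lambda>t::real. a + t *\<^sub>R v))"

text \<open>Incidences take values in \<open>enat\<close>, so a point on infinitely many lines has incidence
  \<open>\<infinity>\<close> rather than the default \<open>card\<close> value \<open>0\<close>. A finite supremum of a nonempty set in
  \<open>enat\<close> is attained, hence is the maximum; for empty \<open>P\<close> it is \<open>0\<close>.\<close>

definition incidence :: "'a set set \<Rightarrow> 'a \<Rightarrow> enat" where
  "incidence L p = (if finite {l \<in> L. p \<in> l} then enat (card {l \<in> L. p \<in> l}) else \<infinity>)"

definition max_incidence :: "'a set \<Rightarrow> 'a set set \<Rightarrow> enat" where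
  "max_incidence P L = (SUP p\<in>P. incidence L p)"

text \<open>The list \<open>ps\<close> runs through points of \<open>P\<close> on \<open>l\<close> in their order along \<open>l\<close>, with no point of
  \<open>P\<close> skipped. Since \<open>v\<close> may be replaced by \<open>- v\<close>, both directions of travel are admitted.\<close>

definition consecutive_points :: "'a::real_vector set \<Rightarrow> 'a set \<Rightarrow> 'a list \<Rightarrow> bool" where
  "consecutive_points P l ps \<longleftrightarrow>
    (\<exists>a v. \<exists>ts::real list.
      v \<noteq> 0 \<and> l = range (\<lambda>t::real. a + t *\<^sub>R v) \<and>
      sorted_wrt (<) ts \<and> ps = map (\<lambda>t. a + t *\<^sub>R v) ts \<and> set ps \<subseteq> P \<and>
      (\<forall>i. Suc i < length ts \<longrightarrow>
        (\<forall>t. ts ! i < t \<and> t < ts ! Suc i \<longrightarrow> a + t *\<^sub>R v \<notin> P)))"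

definition is_repetition :: "'c list \<Rightarrow> bool" where
  "is_repetition xs \<longleftrightarrow> (\<exists>ys. ys \<noteq> [] \<and> xs = ys @ ys)"

definition nonrepetitive_coloring ::
    "'a::real_vector set \<Rightarrow> 'a set set \<Rightarrow> ('a \<Rightarrow> 'c) \<Rightarrow> bool" where
  "nonrepetitive_coloring P L c \<longleftrightarrow>
    (\<forall>l\<in>L. \<forall>ps. consecutive_points P l ps \<longrightarrow> \<not> is_repetition (map c ps))"

end

theory Submission
  imports Defs
begin

text \<open>Rosenfeld's counting argument. Let \<open>N S\<close> be the number of colorings of a finite \<open>S\<close> without a
  repetition on a block of consecutive points contained in \<open>S\<close>. Adding a point \<open>p\<close> multiplies \<open>N\<close> by at
  least \<open>b = 2 * sqrt I\<close>: of the \<open>C * N S\<close> extensions to \<open>p\<close>, those with a repetition on a given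
  block of length \<open>2 * h\<close> through \<open>p\<close> are determined by their values off one half of the block, so
  by induction there are at most \<open>N S / b ^ (h - 1)\<close> of them. At most \<open>2 * h * I\<close> such blocks exist,
  and \<open>b + (\<Sum>h. 2 * h * I / b ^ (h - 1)) \<le> C\<close>. Infinite \<open>P\<close> follows by compactness.\<close>

section \<open>Good colorings and their extensions by one point\<close>

text \<open>The family \<open>E\<close> stands for the blocks and stays abstract until the geometry
  enters. Extensional functions make the set finite for finite \<open>S\<close>, so that it can be
  counted.\<close>

definition good_colorings :: "'a list set \<Rightarrow> nat \<Rightarrow> 'a set \<Rightarrow> ('a \<Rightarrow> nat) set" where
  "good_colorings E C S =
    {c \<in> S \<rightarrow>\<^sub>E {..<C}. \<forall>e\<in>E. set e \<subseteq> S \<longrightarrow> \<not> is_repetition (map c e)}"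

lemma finite_good_colorings: "finite S \<Longrightarrow> finite (good_colorings E C S)"
  unfolding good_colorings_def by (rule finite_subset[of _ "S \<rightarrow>\<^sub>E {..<C}"]) (auto intro: finite_PiE)

lemma restrict_good_colorings:
  assumes "c \<in> good_colorings E C S" "T \<subseteq> S"
  shows "restrict c T \<in> good_colorings E C T"
proof -
  have "\<not> is_repetition (map (restrict c T) e)" if "e \<in> E" "set e \<subseteq> T" for e
  proof -
    have "map (restrict c T) e = map c e" using that by (auto intro!: map_cong)
    moreover have "\<not> is_repetition (map c e)" using assms that unfolding good_colorings_def by auto
    ultimately show ?thesis by metis
  qed
  moreover have "restrict c T \<in> T \<rightarrow>\<^sub>E {..<C}" using assms unfolding good_colorings_def by auto
  ultimately show ?thesis unfolding good_colorings_def by auto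
qed

text \<open>The color of \<open>p\<close> is free because only the restriction to \<open>S\<close>
  is constrained; \<open>c(p := x)\<close> glues it on.\<close>

lemma card_extensions:
  assumes "finite S" "p \<notin> S"
  shows "card {f \<in> insert p S \<rightarrow>\<^sub>E {..<C}. restrict f S \<in> good_colorings E C S}
    = C * card (good_colorings E C S)"
proof -
  let ?A = "{f \<in> insert p S \<rightarrow>\<^sub>E {..<C}. restrict f S \<in> good_colorings E C S}"
  let ?g = "\<lambda>(x, c). (c::'a \<Rightarrow> nat)(p := x)"
  have res: "restrict (c(p := x)) S = c" if "c \<in> good_colorings E C S" for c and x :: nat
    using that assms unfolding good_colorings_def
    by (auto simp: fun_eq_iff restrict_def PiE_def extensional_def)
  have "bij_betw ?g ({..<C} \<times> good_colorings E C S) ?A"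
  proof (rule bij_betwI'[where f = ?g], goal_cases)
    case (1 a b)
    obtain x c y d where [simp]: "a = (x, c)" "b = (y, d)" by (cases a, cases b) auto
    have "x = y \<and> c = d" if "c(p := x) = d(p := y)"
    proof
      show "x = y" using fun_cong[OF that, of p] by simp
      show "c = d" using res[of c x] res[of d y] that 1 by auto
    qed
    then show ?case by auto
  next
    case (2 a)
    obtain x c where a: "a = (x, c)" by (cases a)
    have c: "c \<in> good_colorings E C S" and x: "x < C" using 2 a by auto
    then have "c \<in> S \<rightarrow>\<^sub>E {..<C}" unfolding good_colorings_def by auto
    then have "c(p := x) \<in> insert p S \<rightarrow>\<^sub>E {..<C}" using x by (auto intro!: PiE_fun_upd)
    then show ?case using res[OF c, of x] c a by auto
  next
    case (3 f)
    have "f = (restrict f S)(p := f p)" using 3 assms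
      by (auto simp: fun_eq_iff restrict_def PiE_def extensional_def)
    moreover have "f p < C" using 3 by auto
    ultimately show ?case using 3 by (intro bexI[of _ "(f p, restrict f S)"]) auto
  qed
  from bij_betw_same_card[OF this] show ?thesis
    by (simp add: card_cartesian_product)
qed

text \<open>If \<open>p\<close> completes a repetition along \<open>e\<close>, the half of \<open>e\<close> containing \<open>p\<close> is a copy of the
  other half, so the coloring is determined by its values off that half.\<close>

lemma card_extensions_repetition_le:
  assumes "finite S" "p \<notin> S" "distinct e" "length e = 2 * h" "set e \<subseteq> insert p S" "p \<in> set e"
  obtains T where "T \<subseteq> S" "card (S - T) = h - 1"
    "card {f \<in> insert p S \<rightarrow>\<^sub>E {..<C}. restrict f S \<in> good_colorings E C S \<and>
        is_repetition (map f e)} \<le> card (good_colorings E C T)"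
proof -
  let ?B = "{f \<in> insert p S \<rightarrow>\<^sub>E {..<C}. restrict f S \<in> good_colorings E C S \<and>
        is_repetition (map f e)}"
  define a b where "a = take h e" and "b = drop h e"
  have e: "e = a @ b" "length a = h" "length b = h"
    using assms unfolding a_def b_def by auto
  have rep: "map f a = map f b" if r: "is_repetition (map f e)" for f :: "'a \<Rightarrow> nat"
  proof -
    obtain ys where ys: "map f a @ map f b = ys @ ys"
      using r unfolding is_repetition_def e(1) map_append by blast
    have "length (map f a @ map f b) = length (ys @ ys)" using ys by (rule arg_cong)
    then have "length ys = h" using e(2,3) by simp
    then show ?thesis using ys e by auto
  qed
  \<comment> \<open>\<open>u\<close> is the half containing \<open>p\<close> and \<open>w\<close>
    the other one, so the rest need not distinguish first and second half.\<close>
  obtain u w where uw: "set u \<inter> set w = {}" "set u \<union> set w = set e" "p \<in> set u"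
    "distinct u" "length u = h" "length w = h"
    "\<And>f :: 'a \<Rightarrow> nat. is_repetition (map f e) \<Longrightarrow> map f u = map f w"
  proof (cases "p \<in> set a")
    case True
    then show ?thesis using assms e rep by (intro that[of a b]) auto
  next
    case False
    then show ?thesis using assms e rep by (intro that[of b a]) (auto simp: eq_commute)
  qed
  \<comment> \<open>Dropping \<open>u\<close> removes \<open>p\<close> and \<open>h - 1\<close>
    points of \<open>S\<close>; this is the source of the exponent \<open>h - 1\<close>.\<close>
  define T where "T = insert p S - set u"
  have T: "T \<subseteq> S" using uw unfolding T_def by auto
  have "S - T = set u - {p}" using uw assms unfolding T_def by auto
  then have card: "card (S - T) = h - 1" using uw by (simp add: distinct_card)
  have wT: "set w \<subseteq> T" using uw assms unfolding T_def by auto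
  \<comment> \<open>Agreement on \<open>T\<close> includes agreement on \<open>w\<close>, and a
    repetition copies the colors of \<open>w\<close> onto \<open>u\<close>.\<close>
  have inj: "inj_on (\<lambda>f. restrict f T) ?B"
  proof (rule inj_onI)
    fix f g assume f: "f \<in> ?B" and g: "g \<in> ?B" and eq: "restrict f T = restrict g T"
    have onT: "f x = g x" if "x \<in> T" for x using fun_cong[OF eq, of x] that by auto
    have "map f u = map g u"
    proof -
      have "map f u = map f w" using uw f by auto
      also have "\<dots> = map g w" using onT wT by auto
      also have "\<dots> = map g u" using uw(7)[of g] g by auto
      finally show ?thesis .
    qed
    then have "f x = g x" if "x \<in> insert p S" for x
      using onT[of x] that unfolding T_def by auto
    then show "f = g" using f g by (auto intro: PiE_ext)
  qed
  have "(\<lambda>f. restrict f T) ` ?B \<subseteq> good_colorings E C T"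
  proof
    fix g assume "g \<in> (\<lambda>f. restrict f T) ` ?B"
    then obtain f where f: "f \<in> ?B" "g = restrict f T" by auto
    have "restrict (restrict f S) T \<in> good_colorings E C T"
      using f by (intro restrict_good_colorings[OF _ T]) blast
    moreover have "restrict (restrict f S) T = restrict f T" using T by (simp add: Int_absorb1)
    ultimately show "g \<in> good_colorings E C T" using f by simp
  qed
  then have "card ?B \<le> card (good_colorings E C T)"
    using card_inj_on_le[OF inj] finite_good_colorings finite_subset[OF T assms(1)] by blast
  then show ?thesis using that T card by blast
qed

section \<open>Growth of the number of good colorings\<close>

text \<open>After an index shift this is a partial sum of the derivative of the geometric series,
  whose terms are nonnegative.\<close>

lemma sum_linear_geometric_le:
  fixes x :: real
  assumes "0 \<le> x" "x < 1"
  shows "(\<Sum>h\<in>{1..m}. real h * x ^ (h - 1)) \<le> 1 / (1 - x)\<^sup>2"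
proof -
  have s: "(\<lambda>n. real (Suc n) * x ^ n) sums (1 / (1 - x)\<^sup>2)"
    using geometric_deriv_sums[of x] assms by simp
  have "(\<Sum>h\<in>{1..m}. real h * x ^ (h - 1)) = (\<Sum>n<m. real (Suc n) * x ^ n)"
    by (rule sum.reindex_bij_witness[of _ Suc "\<lambda>h. h - 1"]) auto
  also have "\<dots> \<le> 1 / (1 - x)\<^sup>2"
    using sum_le_suminf[OF sums_summable[OF s], of "{..<m}"] s assms by (simp add: sums_iff)
  finally show ?thesis .
qed

text \<open>The factor \<open>2 * h * I\<close> reflects the position of \<open>p\<close> in a block
  and the line carrying the block. The induction is strong because the extensions spoiled by a block
  of half-length \<open>h\<close> are compared with colorings of a set \<open>h - 1\<close> points
  smaller than \<open>S\<close>.\<close>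

lemma good_colorings_growth:
  fixes b :: real
  assumes dist: "\<And>e. e \<in> E \<Longrightarrow> distinct e"
    and fin: "\<And>p h. finite {e \<in> E. p \<in> set e \<and> length e = 2 * h}"
    and deg: "\<And>p h. card {e \<in> E. p \<in> set e \<and> length e = 2 * h} \<le> 2 * h * I"
    and b: "b > 1" and C: "real C \<ge> b + 2 * real I / (1 - 1 / b)\<^sup>2"
  assumes "finite S" "p \<notin> S"
  shows "real (card (good_colorings E C (insert p S))) \<ge> b * real (card (good_colorings E C S))"
  using assms(6,7)
proof (induction "card S" arbitrary: S p rule: less_induct)
  case less
  let ?N = "\<lambda>T. real (card (good_colorings E C T))"
  \<comment> \<open>Iterates the induction hypothesis from \<open>T\<close> up to \<open>S\<close>,
    one point at a time; it is only applied to proper subsets of \<open>S\<close>.\<close>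
  have grow: "b ^ k * ?N T \<le> ?N S" if "T \<subseteq> S" "card (S - T) = k" for T k
    using that
  proof (induction k arbitrary: T)
    case 0
    then have "T = S" using less.prems by auto
    then show ?case by simp
  next
    case (Suc k)
    then obtain q where q: "q \<in> S - T" by (metis card.empty ex_in_conv nat.distinct(1))
    have "finite T" using Suc.prems less.prems finite_subset by auto
    moreover have "card T < card S" using q Suc.prems less.prems by (intro psubset_card_mono) auto
    ultimately have "b * ?N T \<le> ?N (insert q T)" using less.hyps[of T q] q by auto
    then have "b ^ k * (b * ?N T) \<le> b ^ k * ?N (insert q T)" using b by (intro mult_left_mono) auto
    also have "S - insert q T = (S - T) - {q}" by auto
    then have "card (S - insert q T) = k" using Suc.prems q less.prems by simp
    then have "b ^ k * ?N (insert q T) \<le> ?N S" using Suc.IH[of "insert q T"] Suc.prems q by auto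
    finally show ?case by (simp add: mult_ac)
  qed
  \<comment> \<open>Blocks have distinct entries, so a block inside \<open>insert p S\<close> has
    length at most \<open>card S + 1\<close>; \<open>m\<close> is a generous bound for its
    half-length and keeps the sums finite.\<close>
  define m where "m = card S + 1"
  define A where "A = {f \<in> insert p S \<rightarrow>\<^sub>E {..<C}. restrict f S \<in> good_colorings E C S}"
  define Bad where "Bad = (\<lambda>e. {f \<in> insert p S \<rightarrow>\<^sub>E {..<C}.
    restrict f S \<in> good_colorings E C S \<and> is_repetition (map f e)})"
  define Ep where "Ep = (\<lambda>h. {e \<in> E. p \<in> set e \<and> length e = 2 * h})"
  define Es where "Es = (\<lambda>h. {e \<in> Ep h. set e \<subseteq> insert p S})"
  have finS: "finite (insert p S \<rightarrow>\<^sub>E {..<C})" using less.prems by (auto intro: finite_PiE)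
  have finBad: "finite (Bad e)" for e unfolding Bad_def by (rule finite_subset[OF _ finS]) auto
  have finEs: "finite (Es h)" for h
    using fin[of p h] unfolding Es_def Ep_def by (rule rev_finite_subset) auto
  have cardEs: "card (Es h) \<le> 2 * h * I" for h
    using fin[of p h] unfolding Es_def Ep_def by (rule order_trans[OF card_mono deg]) auto
  \<comment> \<open>An extension that fails repeats on some block, and this block passes through
    \<open>p\<close> because the restriction to \<open>S\<close> is good.\<close>
  have cover: "A \<subseteq> good_colorings E C (insert p S) \<union> (\<Union>h\<in>{1..m}. \<Union>e\<in>Es h. Bad e)"
  proof
    fix f assume f: "f \<in> A"
    show "f \<in> good_colorings E C (insert p S) \<union> (\<Union>h\<in>{1..m}. \<Union>e\<in>Es h. Bad e)"
    proof (cases "f \<in> good_colorings E C (insert p S)")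
      case False
      then obtain e where e: "e \<in> E" "set e \<subseteq> insert p S" "is_repetition (map f e)"
        using f unfolding A_def good_colorings_def by auto
      have p: "p \<in> set e"
      proof (rule ccontr)
        assume "p \<notin> set e"
        then have s: "set e \<subseteq> S" using e by auto
        then have "map (restrict f S) e = map f e" by (auto intro!: map_cong)
        moreover have "\<not> is_repetition (map (restrict f S) e)"
          using f e s unfolding A_def good_colorings_def by blast
        ultimately show False using e by metis
      qed
      obtain ys where ys: "map f e = ys @ ys" "ys \<noteq> []" using e unfolding is_repetition_def by auto
      define h where "h = length ys"
      have len: "length e = 2 * h" using arg_cong[OF ys(1), of length] h_def by auto
      have "length e \<le> card (insert p S)"
        using dist[OF e(1)] card_mono[OF _ e(2)] less.prems by (simp add: distinct_card)
      then have "h \<in> {1..m}" using len ys(2) less.prems h_def unfolding m_def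
        by (auto simp: Suc_le_eq)
      moreover have "e \<in> Es h" using e p len unfolding Es_def Ep_def by auto
      moreover have "f \<in> Bad e" using f e unfolding Bad_def A_def by auto
      ultimately show ?thesis by blast
    qed auto
  qed
  have Bad_le: "real (card (Bad e)) \<le> ?N S * (1 / b) ^ (h - 1)" if "e \<in> Es h" for e h
  proof -
    have e: "e \<in> E" "distinct e" "length e = 2 * h" "set e \<subseteq> insert p S" "p \<in> set e"
      using that dist unfolding Es_def Ep_def by auto
    obtain T where T: "T \<subseteq> S" "card (S - T) = h - 1" "card (Bad e) \<le> card (good_colorings E C T)"
      using card_extensions_repetition_le[OF less.prems e(2-5), of C E] unfolding Bad_def by blast
    have "real (card (Bad e)) \<le> ?N T" using T by simp
    also have "\<dots> \<le> ?N S * (1 / b) ^ (h - 1)"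
      using grow[OF T(1,2)] b by (simp add: power_one_over field_simps)
    finally show ?thesis .
  qed
  have "card A \<le> card (good_colorings E C (insert p S) \<union> (\<Union>h\<in>{1..m}. \<Union>e\<in>Es h. Bad e))"
    using cover finite_good_colorings[of "insert p S"] less.prems finEs finBad
    by (intro card_mono) auto
  also have "\<dots> \<le> card (good_colorings E C (insert p S)) + card (\<Union>h\<in>{1..m}. \<Union>e\<in>Es h. Bad e)"
    by (rule card_Un_le)
  also have "card (\<Union>h\<in>{1..m}. \<Union>e\<in>Es h. Bad e) \<le> (\<Sum>h\<in>{1..m}. card (\<Union>e\<in>Es h. Bad e))"
    by (rule card_UN_le) auto
  also have "\<dots> \<le> (\<Sum>h\<in>{1..m}. \<Sum>e\<in>Es h. card (Bad e))"
    by (intro sum_mono card_UN_le finEs)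
  finally have "card A \<le> card (good_colorings E C (insert p S))
      + (\<Sum>h\<in>{1..m}. \<Sum>e\<in>Es h. card (Bad e))" by simp
  then have "real (card A) \<le> ?N (insert p S) + (\<Sum>h\<in>{1..m}. \<Sum>e\<in>Es h. real (card (Bad e)))"
    by (simp flip: of_nat_sum of_nat_add)
  also have "(\<Sum>h\<in>{1..m}. \<Sum>e\<in>Es h. real (card (Bad e)))
      \<le> (\<Sum>h\<in>{1..m}. real (2 * h * I) * (?N S * (1 / b) ^ (h - 1)))"
  proof (rule sum_mono)
    fix h
    have "(\<Sum>e\<in>Es h. real (card (Bad e))) \<le> real (card (Es h)) * (?N S * (1 / b) ^ (h - 1))"
      by (intro sum_bounded_above Bad_le)
    also have "\<dots> \<le> real (2 * h * I) * (?N S * (1 / b) ^ (h - 1))"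
      using cardEs[of h] b by (intro mult_right_mono) (auto simp only: of_nat_le_iff, auto)
    finally show "(\<Sum>e\<in>Es h. real (card (Bad e))) \<le> real (2 * h * I) * (?N S * (1 / b) ^ (h - 1))" .
  qed
  also have "\<dots> = 2 * real I * ?N S * (\<Sum>h\<in>{1..m}. real h * (1 / b) ^ (h - 1))"
    by (simp add: sum_distrib_left mult_ac)
  also have "\<dots> \<le> 2 * real I * ?N S * (1 / (1 - 1 / b)\<^sup>2)"
    using b by (intro mult_left_mono sum_linear_geometric_le) auto
  finally have 1: "real (card A) \<le> ?N (insert p S) + 2 * real I * ?N S * (1 / (1 - 1 / b)\<^sup>2)"
    by simp
  \<comment> \<open>All \<open>C\<close> extensions of each good coloring are counted in
    \<open>A\<close>. By the choice of \<open>C\<close> at most \<open>C - b\<close> per coloring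
    are lost, so at least \<open>b\<close> remain on average.\<close>
  have "real (card A) = real C * ?N S"
    using card_extensions[OF less.prems] unfolding A_def by simp
  moreover have "(b + 2 * real I / (1 - 1 / b)\<^sup>2) * ?N S \<le> real C * ?N S"
    using C by (intro mult_right_mono) auto
  ultimately show ?case using 1 by (simp add: algebra_simps)
qed

lemma good_colorings_nonempty_finite:
  fixes b :: real
  assumes "\<And>e. e \<in> E \<Longrightarrow> distinct e"
    and "\<And>p h. finite {e \<in> E. p \<in> set e \<and> length e = 2 * h}"
    and "\<And>p h. card {e \<in> E. p \<in> set e \<and> length e = 2 * h} \<le> 2 * h * I"
    and "b > 1" and "real C \<ge> b + 2 * real I / (1 - 1 / b)\<^sup>2"
    and "finite S"
  shows "good_colorings E C S \<noteq> {}"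
proof -
  have "card (good_colorings E C S) > 0"
    using assms(6)
  proof induction
    \<comment> \<open>The only extensional function on the empty set is constantly
      \<open>undefined\<close>, and the only block inside it is \<open>[]\<close>, which is no
      repetition.\<close>
    case empty
    have "good_colorings E C {} = {\<lambda>x. undefined}"
      unfolding good_colorings_def by (auto simp: is_repetition_def)
    then show ?case by simp
  next
    case (insert p S)
    then have "0 < b * real (card (good_colorings E C S))" using assms(4) by simp
    then show ?case using good_colorings_growth[OF assms(1-5) insert(1,2)] by simp
  qed
  then show ?thesis by auto
qed

section \<open>Compactness: from finite to infinite point sets\<close>

text \<open>By Tychonoff the colorings form a compact space, a product of finite discrete spaces.
  Each block cuts out a closed set, and finitely many blocks involve finitely many points, which
  gives the finite intersection property.\<close>

lemma good_colorings_compactness: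
  assumes "\<And>S. finite S \<Longrightarrow> S \<subseteq> P \<Longrightarrow> good_colorings E C S \<noteq> {}" and "C > 0"
  shows "good_colorings E C P \<noteq> {}"
proof -
  define X where "X = product_topology (\<lambda>_::'a. discrete_topology {..<C}) P"
  define K where "K = (\<lambda>e. {c \<in> P \<rightarrow>\<^sub>E {..<C}. \<not> is_repetition (map c e)})"
  define EP where "EP = {e \<in> E. set e \<subseteq> P}"
  have top: "topspace X = P \<rightarrow>\<^sub>E {..<C}" unfolding X_def by simp
  have compact: "compact_space X"
    unfolding X_def by (auto simp: compact_space_product_topology compact_space_discrete_topology)
  have closed: "closedin X (K e)" if "e \<in> EP" for e
  proof -
    have "openin X (topspace X - K e)"
    proof (subst openin_subopen, intro ballI)
      fix c assume c: "c \<in> topspace X - K e"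
      \<comment> \<open>A repetition on \<open>e\<close> depends only on the finitely many colors
        along \<open>e\<close>; this cylinder fixes exactly those.\<close>
      let ?U = "Pi\<^sub>E P (\<lambda>x. if x \<in> set e then {c x} else {..<C})"
      have cP: "c \<in> P \<rightarrow>\<^sub>E {..<C}" and rep: "is_repetition (map c e)"
        using c unfolding top K_def by auto
      have "openin X ?U"
        unfolding X_def
      proof (rule product_topology_basis)
        show "finite {i. (if i \<in> set e then {c i} else {..<C}) \<noteq> topspace (discrete_topology {..<C})}"
          by (rule finite_subset[of _ "set e"]) auto
        show "openin (discrete_topology {..<C}) (if x \<in> set e then {c x} else {..<C})" for x
          using cP that unfolding EP_def by auto
      qed
      moreover have "c \<in> ?U" using cP by (auto simp: PiE_iff)
      moreover have "?U \<subseteq> topspace X - K e"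
      proof
        fix d assume d: "d \<in> ?U"
        have "d \<in> P \<rightarrow>\<^sub>E {..<C}" using d cP by (auto simp: PiE_iff split: if_splits)
        moreover have "map d e = map c e"
          using d that unfolding EP_def by (auto simp: PiE_iff split: if_splits)
        ultimately show "d \<in> topspace X - K e" using rep unfolding top K_def
          by (metis (no_types, lifting) DiffI mem_Collect_eq)
      qed
      ultimately show "\<exists>T. openin X T \<and> c \<in> T \<and> T \<subseteq> topspace X - K e" by blast
    qed
    moreover have "K e \<subseteq> topspace X" unfolding top K_def by auto
    ultimately show ?thesis by (simp add: closedin_def)
  qed
  have ne: "\<Inter>\<F> \<noteq> {}" if "finite \<F>" "\<F> \<subseteq> insert (topspace X) (K ` EP)" for \<F>
  proof -
    have "finite (\<F> - {topspace X})" "\<F> - {topspace X} \<subseteq> K ` EP" using that by auto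
    then obtain D where D: "finite D" "D \<subseteq> EP" "\<F> - {topspace X} = K ` D"
      using finite_subset_image by metis
    define S where "S = (\<Union>e\<in>D. set e)"
    have "finite S" "S \<subseteq> P" using D unfolding S_def EP_def by auto
    then obtain c where c: "c \<in> good_colorings E C S" using assms by blast
    \<comment> \<open>Color \<open>0\<close> on the rest of \<open>P\<close> is available since
      \<open>C > 0\<close>; outside \<open>P\<close> extensionality forces
      \<open>undefined\<close>.\<close>
    define d where "d = (\<lambda>x. if x \<in> S then c x else if x \<in> P then 0 else undefined)"
    have d: "d \<in> P \<rightarrow>\<^sub>E {..<C}"
      using c \<open>C > 0\<close> \<open>S \<subseteq> P\<close> unfolding d_def good_colorings_def by (auto simp: PiE_iff extensional_def)
    have "d \<in> K e" if "e \<in> D" for e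
    proof -
      have s: "set e \<subseteq> S" using that unfolding S_def by auto
      then have "map d e = map c e" unfolding d_def by auto
      moreover have "\<not> is_repetition (map c e)"
        using c s that D unfolding good_colorings_def EP_def by blast
      ultimately show ?thesis using d unfolding K_def by (metis (no_types, lifting) mem_Collect_eq)
    qed
    moreover have "\<F> \<subseteq> insert (topspace X) (K ` D)" using D(3) by blast
    ultimately have "d \<in> \<Inter>\<F>" using d unfolding top by blast
    then show ?thesis by auto
  qed
  \<comment> \<open>With \<open>topspace X\<close> in the family, a common element is a coloring
    even if \<open>EP\<close> is empty.\<close>
  have "\<Inter>(insert (topspace X) (K ` EP)) \<noteq> {}"
  proof (rule compact[unfolded compact_space_fip, rule_format], intro conjI ballI allI impI)
    show "closedin X D" if "D \<in> insert (topspace X) (K ` EP)" for D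
      using that closed by auto
    show "\<Inter>\<F> \<noteq> {}" if "finite \<F> \<and> \<F> \<subseteq> insert (topspace X) (K ` EP)" for \<F>
      using that ne by blast
  qed
  then obtain c where "c \<in> topspace X" "\<And>e. e \<in> EP \<Longrightarrow> c \<in> K e" by auto
  then have "c \<in> good_colorings E C P"
    unfolding top K_def EP_def good_colorings_def by auto
  then show ?thesis by auto
qed

section \<open>Consecutive parameters on a line\<close>

text \<open>The order-theoretic content of \<open>consecutive_points\<close>, moved from the line to
  its parameters.\<close>

definition consecutive_in :: "'a::linorder set \<Rightarrow> 'a list \<Rightarrow> bool" where
  "consecutive_in Q ts \<longleftrightarrow> sorted_wrt (<) ts \<and> set ts \<subseteq> Q \<and>
    (\<forall>i. Suc i < length ts \<longrightarrow> (\<forall>t. ts ! i < t \<and> t < ts ! Suc i \<longrightarrow> t \<notin> Q))"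

lemma consecutive_points_iff:
  "consecutive_points P l ps \<longleftrightarrow>
    (\<exists>a v ts. v \<noteq> 0 \<and> l = range (\<lambda>t::real. a + t *\<^sub>R v) \<and>
      consecutive_in {t. a + t *\<^sub>R v \<in> P} ts \<and> ps = map (\<lambda>t. a + t *\<^sub>R v) ts)"
  unfolding consecutive_points_def consecutive_in_def
  by (rule ex_cong1, rule ex_cong1, rule ex_cong1) auto

text \<open>Since no element of \<open>Q\<close> lies in a gap, each entry determines its successor
  and its predecessor, so equality spreads from position \<open>j\<close> in both
  directions.\<close>

lemma consecutive_in_unique:
  assumes "consecutive_in Q ts" "consecutive_in Q us" "length ts = length us"
    "j < length ts" "ts ! j = us ! j"
  shows "ts = us"
proof -
  have inQ: "ts ! i \<in> Q" "us ! i \<in> Q" if "i < length ts" for i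
    using assms that unfolding consecutive_in_def by (auto simp: subset_iff)
  have less: "ts ! i < ts ! Suc i" "us ! i < us ! Suc i" if "Suc i < length ts" for i
    using assms that unfolding consecutive_in_def by (auto simp: sorted_wrt_iff_nth_less)
  have gap: "\<not> (ts ! i < t \<and> t < ts ! Suc i)" "\<not> (us ! i < t \<and> t < us ! Suc i)"
    if "Suc i < length ts" "t \<in> Q" for i t
    using assms that unfolding consecutive_in_def by auto
  have succ_iff: "ts ! i = us ! i \<longleftrightarrow> ts ! Suc i = us ! Suc i" if i: "Suc i < length ts" for i
    using less[OF i] inQ[OF i] inQ[OF Suc_lessD[OF i]] gap[OF i]
    by (metis linorder_neqE)
  have "ts ! i = us ! i" if "i < length ts" for i
  proof (cases "j \<le> i")
    case True
    then show ?thesis using that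
    proof (induction i rule: dec_induct)
      case base then show ?case using assms by simp
    next
      case (step n) then show ?case using succ_iff[of n] by auto
    qed
  next
    case False
    then have "i \<le> j" by simp
    then show ?thesis
    proof (induction i rule: inc_induct)
      case base then show ?case using assms by simp
    next
      case (step n) then show ?case using succ_iff[of n] assms(4) by auto
    qed
  qed
  then show ?thesis using assms(3) by (simp add: list_eq_iff_nth_eq)
qed

lemma consecutive_in_affine_pos:
  fixes g r :: real
  assumes "g > 0" and "consecutive_in {t. r + g * t \<in> Q} ts"
  shows "consecutive_in Q (map (\<lambda>t. r + g * t) ts)"
proof -
  have "t \<notin> Q" if "Suc i < length ts" "r + g * ts ! i < t" "t < r + g * ts ! Suc i" for i t
  proof -
    have "ts ! i < (t - r) / g" "(t - r) / g < ts ! Suc i"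
      using that assms(1) by (auto simp: field_simps)
    then have "r + g * ((t - r) / g) \<notin> Q" using assms(2) that(1) unfolding consecutive_in_def by blast
    moreover have "r + g * ((t - r) / g) = t" using assms(1) by simp
    ultimately show ?thesis by simp
  qed
  then show ?thesis using assms unfolding consecutive_in_def
    by (auto simp: sorted_wrt_map)
qed

lemma consecutive_in_uminus:
  fixes ts :: "real list"
  assumes "consecutive_in {t. - t \<in> Q} ts"
  shows "consecutive_in Q (rev (map uminus ts))"
proof -
  have "t \<notin> Q" if i: "Suc i < length ts"
    and t: "rev (map uminus ts) ! i < t" "t < rev (map uminus ts) ! Suc i" for i t
  proof -
    \<comment> \<open>The gap after position \<open>i\<close> of the reversed list is the gap
      between \<open>k\<close> and \<open>Suc k\<close> in \<open>ts\<close>.\<close>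
    define k where "k = length ts - Suc (Suc i)"
    have k: "Suc k < length ts" "length ts - Suc i = Suc k" using i unfolding k_def by auto
    have "rev (map uminus ts) ! i = - ts ! Suc k" "rev (map uminus ts) ! Suc i = - ts ! k"
      using i k by (auto simp: rev_nth k_def)
    then have "ts ! k < - t" "- t < ts ! Suc k" using t by auto
    then have "- (- t) \<notin> Q" using assms k unfolding consecutive_in_def by blast
    then show ?thesis by simp
  qed
  then show ?thesis using assms unfolding consecutive_in_def
    by (auto simp: sorted_wrt_map sorted_wrt_rev)
qed

lemma line_reparametrization:
  fixes a v a' v' :: "'a::real_vector"
  assumes "v' \<noteq> 0" "range (\<lambda>t::real. a + t *\<^sub>R v) = range (\<lambda>t. a' + t *\<^sub>R v')"
  obtains r g :: real where "g \<noteq> 0" "\<And>t. a' + t *\<^sub>R v' = a + (r + g * t) *\<^sub>R v"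
proof -
  \<comment> \<open>The points with parameters 0 and 1 in the second parametrization have parameters
    \<open>r\<close> and \<open>s\<close> in the first, so the slope is
    \<open>s - r\<close>.\<close>
  have "a' + 0 *\<^sub>R v' \<in> range (\<lambda>t. a + t *\<^sub>R v)" "a' + 1 *\<^sub>R v' \<in> range (\<lambda>t. a + t *\<^sub>R v)"
    unfolding assms(2) by blast+
  then obtain r s where r: "a' = a + r *\<^sub>R v" and s: "a' + v' = a + s *\<^sub>R v"
    unfolding image_iff by (metis add.right_neutral scaleR_one scaleR_zero_left)
  have v': "v' = (s - r) *\<^sub>R v" using r s by (simp add: algebra_simps)
  then have "s - r \<noteq> 0" using assms(1) by auto
  moreover have "a' + t *\<^sub>R v' = a + (r + (s - r) * t) *\<^sub>R v" for t
    unfolding v' r by (simp add: algebra_simps)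
  ultimately show ?thesis using that by blast
qed

text \<open>Two parametrizations of a line differ by an affine change of parameter; a negative slope
  reverses the order, which accounts for \<open>rev ps\<close>.\<close>

lemma consecutive_points_fixed_parametrization:
  assumes "consecutive_points P l ps" "l = range (\<lambda>t::real. a + t *\<^sub>R v)"
  obtains ts where "consecutive_in {t. a + t *\<^sub>R v \<in> P} ts"
    "map (\<lambda>t. a + t *\<^sub>R v) ts = ps \<or> map (\<lambda>t. a + t *\<^sub>R v) ts = rev ps"
proof -
  obtain a' v' us where u: "v' \<noteq> 0" "l = range (\<lambda>t::real. a' + t *\<^sub>R v')"
    "consecutive_in {t. a' + t *\<^sub>R v' \<in> P} us" "ps = map (\<lambda>t. a' + t *\<^sub>R v') us"
    using assms(1) unfolding consecutive_points_iff by blast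
  obtain r g where g: "g \<noteq> 0" "\<And>t. a' + t *\<^sub>R v' = a + (r + g * t) *\<^sub>R v"
    using line_reparametrization[of v' a v a'] u assms(2) by metis
  let ?Q = "{t. a + t *\<^sub>R v \<in> P}"
  have c: "consecutive_in {t. r + g * t \<in> ?Q} us" using u(3) g(2) by simp
  have neg: "- (- r + - g * t) = r + g * t" for t by simp
  show ?thesis
  proof (cases "g > 0")
    case True
    show ?thesis
      using consecutive_in_affine_pos[OF True c] u(4) g(2)
      by (intro that[of "map (\<lambda>t. r + g * t) us"]) auto
  next
    case False
    then have "- g > 0" using g by simp
    \<comment> \<open>A change with slope \<open>g < 0\<close> is one with slope
      \<open>- g > 0\<close> followed by negation; \<open>neg\<close> records this.\<close>
    then have "consecutive_in {t. - t \<in> ?Q} (map (\<lambda>t. - r + (- g) * t) us)"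
      using c by (intro consecutive_in_affine_pos) (simp_all only: mem_Collect_eq neg)
    from consecutive_in_uminus[OF this] show ?thesis
      using u(4) g(2) by (intro that[of "rev (map uminus (map (\<lambda>t. - r + (- g) * t) us))"])
        (auto simp: rev_map algebra_simps)
  qed
qed

section \<open>Blocks through a given point\<close>

text \<open>Serves the blocks traversed against the chosen direction of their line.\<close>

lemma is_repetition_rev: "is_repetition (rev xs) \<Longrightarrow> is_repetition xs"
  unfolding is_repetition_def by (metis rev_append rev_is_Nil_conv rev_rev_ident)

text \<open>Fixing one parametrization of each line makes every block of consecutive points appear in one
  direction only. Counting both directions would double the bound on the blocks through a point,
  and with it the leading term \<open>2 * I\<close>.\<close>

definition line_blocks ::
    "('a::real_vector set \<Rightarrow> 'a) \<Rightarrow> ('a set \<Rightarrow> 'a) \<Rightarrow> 'a set \<Rightarrow> 'a set \<Rightarrow> 'a list set" where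
  "line_blocks a v P l =
    (\<lambda>ts. map (\<lambda>t. a l + t *\<^sub>R v l) ts) ` {ts. consecutive_in {t. a l + t *\<^sub>R v l \<in> P} ts}"

text \<open>A nonzero direction makes the parametrization injective, which reduces the claim to
  \<open>consecutive_in_unique\<close>.\<close>

lemma line_blocks_unique:
  assumes "v l \<noteq> 0" "e \<in> line_blocks a v P l" "f \<in> line_blocks a v P l"
    "length e = length f" "j < length e" "e ! j = f ! j"
  shows "e = f"
proof -
  obtain ts us where t: "consecutive_in {t. a l + t *\<^sub>R v l \<in> P} ts"
      "e = map (\<lambda>t. a l + t *\<^sub>R v l) ts"
    and u: "consecutive_in {t. a l + t *\<^sub>R v l \<in> P} us" "f = map (\<lambda>t. a l + t *\<^sub>R v l) us"
    using assms(2,3) unfolding line_blocks_def by blast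
  have "ts ! j = us ! j" using assms t u by auto
  then show ?thesis using consecutive_in_unique[OF t(1) u(1)] assms t u by auto
qed

text \<open>A block of length \<open>n\<close> is recovered from its line and the position of
  \<open>p\<close> in it, and there are at most \<open>I\<close> lines and \<open>n\<close>
  positions.\<close>

lemma line_blocks_through_point:
  fixes P :: "'a::real_vector set"
  assumes "\<And>l. l \<in> L \<Longrightarrow> v l \<noteq> 0 \<and> l = range (\<lambda>t::real. a l + t *\<^sub>R v l)"
    and "finite {l \<in> L. p \<in> l}" "card {l \<in> L. p \<in> l} \<le> I"
  shows "finite {e \<in> (\<Union>l\<in>L. line_blocks a v P l). p \<in> set e \<and> length e = n}"
    "card {e \<in> (\<Union>l\<in>L. line_blocks a v P l). p \<in> set e \<and> length e = n} \<le> n * I"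
proof -
  let ?E = "{e \<in> (\<Union>l\<in>L. line_blocks a v P l). p \<in> set e \<and> length e = n}"
  let ?D = "{l \<in> L. p \<in> l} \<times> {..<n}"
  \<comment> \<open>Pairs without such a block get an arbitrary value, which is harmless because
    \<open>F\<close> only has to cover \<open>?E\<close>.\<close>
  define F where "F = (\<lambda>(l, j). THE e. e \<in> line_blocks a v P l \<and> length e = n \<and> e ! j = p)"
  have sub: "?E \<subseteq> F ` ?D"
  proof
    fix e assume "e \<in> ?E"
    then obtain l j where e: "l \<in> L" "e \<in> line_blocks a v P l" "length e = n" "j < n" "e ! j = p"
      by (auto simp: in_set_conv_nth)
    have "p \<in> range (\<lambda>t::real. a l + t *\<^sub>R v l)"
      using e nth_mem[of j e] unfolding line_blocks_def by auto
    then have "p \<in> l" using assms(1) e by blast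
    moreover have "F (l, j) = e" unfolding F_def using e assms(1)
      by (auto intro!: the_equality line_blocks_unique[where v = v and l = l and j = j])
    ultimately show "e \<in> F ` ?D" using e by (intro image_eqI[of _ _ "(l, j)"]) auto
  qed
  have fin: "finite ?D" using assms by auto
  show "finite ?E" using sub fin finite_subset by blast
  have "card ?E \<le> card ?D" using surj_card_le[OF fin sub] .
  also have "\<dots> \<le> n * I" using assms by (simp add: card_cartesian_product)
  finally show "card ?E \<le> n * I" .
qed

section \<open>Numerical bound and conclusion\<close>

text \<open>With \<open>s = sqrt I\<close>, the rate \<open>b = 2 * s\<close> takes up
  \<open>2 * s\<close> of the available \<open>10 * s\<close>; that the other term fits under
  \<open>2 * s\<^sup>2 + 8 * s\<close> is a polynomial inequality.\<close>

lemma growth_rate_bound: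
  assumes "I > 2"
  shows "2 * sqrt (real I) + 2 * real I / (1 - 1 / (2 * sqrt (real I)))\<^sup>2
    \<le> 2 * real I + 10 * sqrt (real I)"
proof -
  define s where "s = sqrt (real I)"
  have I: "sqrt (real I) = s" "real I = s\<^sup>2" unfolding s_def by simp_all
  \<comment> \<open>\<open>I \<ge> 3\<close> exceeds \<open>9/4\<close>; the bound on
    \<open>s\<close> makes \<open>4 * s - 5\<close> below positive.\<close>
  have s: "s > 3/2" unfolding s_def using assms by (intro real_less_rsqrt) (auto simp: power2_eq_square)
  have eq: "2 * s\<^sup>2 / (1 - 1 / (2 * s))\<^sup>2 = 8 * s ^ 4 / (2 * s - 1)\<^sup>2"
    using s by (simp add: field_simps power2_eq_square power4_eq_xxxx)
  have "8 * s ^ 4 \<le> (2 * s\<^sup>2 + 8 * s) * (2 * s - 1)\<^sup>2"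
  proof -
    have "0 \<le> 2 * s * (3 * s * (4 * s - 5) + 4)" using s by auto
    also have "\<dots> = (2 * s\<^sup>2 + 8 * s) * (2 * s - 1)\<^sup>2 - 8 * s ^ 4"
      by (simp add: algebra_simps power2_eq_square power4_eq_xxxx)
    finally show ?thesis by simp
  qed
  then have "8 * s ^ 4 / (2 * s - 1)\<^sup>2 \<le> 2 * s\<^sup>2 + 8 * s"
    using s by (simp add: pos_divide_le_eq)
  then show ?thesis using eq unfolding I(1) unfolding I(2) by linarith
qed

theorem theorem3:
  fixes P :: "(real ^ 'n) set" and L :: "(real ^ 'n) set set" and I C :: nat
  assumes "discrete P"
    and "\<forall>l\<in>L. is_line l"
    and "max_incidence P L = enat I"
    and "I > 2"
    and "C > 0"
    and "real C \<ge> 2 * real I + 10 * sqrt (real I)"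
  shows "\<exists>c :: real ^ 'n \<Rightarrow> nat. c \<in> P \<rightarrow> {..<C} \<and> nonrepetitive_coloring P L c"
proof -
  obtain a v where av: "\<And>l. l \<in> L \<Longrightarrow> v l \<noteq> 0 \<and> l = range (\<lambda>t::real. a l + t *\<^sub>R v l)"
    using assms(2) unfolding is_line_def by metis
  define E where "E = (\<Union>l\<in>L. line_blocks a v P l)"
  have inP: "set e \<subseteq> P" if "e \<in> E" for e
    using that unfolding E_def line_blocks_def consecutive_in_def by auto
  have dist: "distinct e" if "e \<in> E" for e
  proof -
    obtain l ts where l: "l \<in> L" "consecutive_in {t. a l + t *\<^sub>R v l \<in> P} ts"
      "e = map (\<lambda>t. a l + t *\<^sub>R v l) ts" using \<open>e \<in> E\<close> unfolding E_def line_blocks_def by auto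
    have "distinct ts" using l(2) unfolding consecutive_in_def by (simp add: strict_sorted_iff)
    then show ?thesis using l av[of l] by (auto simp: distinct_map inj_on_def)
  qed
  \<comment> \<open>A finite maximum excludes the incidence \<open>\<infinity>\<close>, so
    \<open>card\<close> is the true number of lines.\<close>
  have inc: "finite {l \<in> L. p \<in> l}" "card {l \<in> L. p \<in> l} \<le> I" if "p \<in> P" for p
  proof -
    have "incidence L p \<le> enat I"
      using SUP_upper[OF that, of "incidence L"] assms(3) unfolding max_incidence_def by simp
    then show "finite {l \<in> L. p \<in> l}" "card {l \<in> L. p \<in> l} \<le> I"
      unfolding incidence_def by (auto split: if_splits)
  qed
  have deg: "finite {e \<in> E. p \<in> set e \<and> length e = 2 * h} \<and>
    card {e \<in> E. p \<in> set e \<and> length e = 2 * h} \<le> 2 * h * I" for p h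
  proof (cases "p \<in> P")
    case True
    show ?thesis using line_blocks_through_point[OF av inc[OF True]] unfolding E_def by simp
  next
    case False
    then have "{e \<in> E. p \<in> set e \<and> length e = 2 * h} = {}" using inP by auto
    then show ?thesis by (metis card.empty finite.emptyI le0)
  qed
  have "2 * sqrt (real I) > 1"
  proof -
    have "sqrt (real I) \<ge> 1" using assms(4) by simp
    then show ?thesis by linarith
  qed
  then have "good_colorings E C S \<noteq> {}" if "finite S" for S
    using good_colorings_nonempty_finite[of E I "2 * sqrt (real I)" C S]
      growth_rate_bound[OF assms(4)] assms(6) dist deg that by fastforce
  then obtain c where c: "c \<in> good_colorings E C P"
    using good_colorings_compactness[of P E C] assms(5) by blast
  have "nonrepetitive_coloring P L c"
    unfolding nonrepetitive_coloring_def
  proof (intro ballI allI impI notI)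
    \<comment> \<open>If \<open>ps\<close> runs against the chosen direction of \<open>l\<close>,
      its reverse lies in \<open>E\<close> and is a repetition as well.\<close>
    fix l ps assume l: "l \<in> L" "consecutive_points P l ps" "is_repetition (map c ps)"
    obtain ts where ts: "consecutive_in {t. a l + t *\<^sub>R v l \<in> P} ts"
      "map (\<lambda>t. a l + t *\<^sub>R v l) ts = ps \<or> map (\<lambda>t. a l + t *\<^sub>R v l) ts = rev ps"
      using consecutive_points_fixed_parametrization[OF l(2)] av[OF l(1)] by metis
    define e where "e = map (\<lambda>t. a l + t *\<^sub>R v l) ts"
    have e: "e \<in> E" using ts(1) l(1) unfolding e_def E_def line_blocks_def by blast
    have "ps = e \<or> ps = rev e" using ts(2) unfolding e_def by auto
    then have "is_repetition (map c e)"
      using l(3) is_repetition_rev[of "map c e"] by (auto simp: rev_map)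
    then show False using c e inP[OF e] unfolding good_colorings_def by auto
  qed
  then show ?thesis using c unfolding good_colorings_def by auto
qed

end
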